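(* Let $X$ be a real $n\times m$ matrix, let $\mathcal{T}_u$ be a tiling on $[n]\times[m]$, and let $(\mathcal{T}_{H_1},\mathcal{T}_{H_2})$ be a pair of hypothesis tilings. Let $\mathcal{H}=\langle \mathcal{T}_u+\mathcal{T}_{H_1},\,\mathcal{T}_u+\mathcal{T}_{H_2}\rangle$, and let $\Sigma_1$ and $\Sigma_2$ be the $m\times m$ covariance matrices of the uniform distributions on $\Omega_{\mathcal{T}_u+\mathcal{T}_{H_1}}$ and $\Omega_{\mathcal{T}_u+\mathcal{T}_{H_2}}$, respectively. Let $W\in\mathbb{R}^{m\times m}$ be a whitening matrix, i.e. $W^T\Sigma_2W=I$, and let $w$ be the first principal component of $W^T\Sigma_1W$. Then $v_{\mathcal{H}}=Ww$ is a solution of the optimisation problem $$\max_{v\in\mathbb{R}^m,\ v\neq0} G(v,\mathcal{H}),\qquad G(v,\mathcal{H})=\frac{v^T\Sigma_1v}{v^T\Sigma_2v},$$ that is, $G(Ww,\mathcal{H})\ge G(v,\mathcal{H})$ for all nonzero $v\in\mathbb{R}^m$.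
   Context: Write $[k]=\{1,\dots,k\}$. $\mathcal{P}_n$ is the set of bijections $[n]\to[n]$, and $\mathcal{P}_n^m$ is the set of vectors $\Pi=(\pi_1,\dots,\pi_m)$ with $\pi_j\in\mathcal{P}_n$. For an $n\times m$ matrix $X$, $\Pi(X)$ is the matrix $\widehat X$ with $\widehat X(i,j)=X(\pi_j(i),j)$. A tile is a pair $t=(R,C)$ with $R\subseteq[n]$, $C\subseteq[m]$. $\Pi$ is allowed by $t=(R,C)$ iff for all $i\in[n]$, $j,j'\in[m]$: $i\in R$ and $j,j'\in C$ imply $\pi_j(i)\in R$ and $\pi_j(i)=\pi_{j'}(i)$. $\Pi$ is allowed by a set of tiles iff it is allowed by each tile in it. Two tiles $(R_1,C_1)$, $(R_2,C_2)$ overlap if $R_1\cap R_2\ne\emptyset$ and $C_1\cap C_2\neq\emptyset$; a tiling is a set of tiles no two distinct members of which overlap. Two sets of tiles are equivalent if they allow exactly the same $\Pi\in\mathcal{P}_n^m$. For tilings $\mathcal{T},\mathcal{T}'$, $\mathcal{T}+\mathcal{T}'$ denotes a tiling equivalent to the set of tiles $\mathcal{T}\cup\mathcal{T}'$. For a set of tiles $T$, $\Omega_T=\{\Pi(X):\Pi\in\mathcal{P}_n^m,\ \Pi\text{ is allowed by }T\}$ (this depends on $T$ only up to equivalence). Pair of hypothesis tilings: given $R\subseteq[n]$, $C\subseteq[m]$ and a partition $C=C_1\cup\dots\cup C_k$ into pairwise disjoint sets, $\mathcal{T}_{H_1}=\{(R,C)\}$ and $\mathcal{T}_{H_2}=\{(R,C_1),\dots,(R,C_k)\}$.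 Covariance matrix of the uniform distribution on $\Omega_T$: the $m\times m$ matrix with entries $\Sigma(j,j')=E\left[\frac1n\sum_{i=1}^nY(\pi_j(i),j)Y(\pi_{j'}(i),j')\right]$, where $Y(i,l)=X(i,l)-\frac1n\sum_{k=1}^nX(k,l)$ and $\Pi=(\pi_1,\dots,\pi_m)$ is uniformly distributed over the vectors in $\mathcal{P}_n^m$ allowed by $T$. The first principal component of a symmetric positive semidefinite matrix $A$ is a unit eigenvector of $A$ for its largest eigenvalue. *)

theory Defs
  imports "HOL-Probability.Probability"
begin

text \<open>
  Rows are indexed by a finite type \<open>'n\<close> and columns by a finite type \<open>'m\<close>, so that an
  n x m data matrix has type \<open>real^'m^'n\<close>, with \<open>X $ i $ j\<close> its entry in row \<open>i\<close> and column
  \<open>j\<close>. A vector of permutations is a function \<open>p\<close>, where \<open>p j\<close> permutes the rows of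
  column \<open>j\<close>.
\<close>

type_synonym ('n, 'm) tile = "'n set \<times> 'm set"

definition perm_vectors :: "('m \<Rightarrow> 'n \<Rightarrow> 'n) set" where
  "perm_vectors = {p. \<forall>j. bij (p j)}"

definition permute_matrix :: "('m \<Rightarrow> 'n \<Rightarrow> 'n) \<Rightarrow> real^'m^'n \<Rightarrow> real^'m^'n" where
  "permute_matrix p X = (\<chi> i j. X $ (p j i) $ j)"

definition allowed_by_tile :: "('n, 'm) tile \<Rightarrow> ('m \<Rightarrow> 'n \<Rightarrow> 'n) \<Rightarrow> bool" where
  "allowed_by_tile t p \<longleftrightarrow>
     (\<forall>i j j'. i \<in> fst t \<and> j \<in> snd t \<and> j' \<in> snd t \<longrightarrow> p j i \<in> fst t \<and> p j i = p j' i)"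

definition allowed :: "('n, 'm) tile set \<Rightarrow> ('m \<Rightarrow> 'n \<Rightarrow> 'n) set" where
  "allowed T = {p \<in> perm_vectors. \<forall>t\<in>T. allowed_by_tile t p}"

definition overlap :: "('n, 'm) tile \<Rightarrow> ('n, 'm) tile \<Rightarrow> bool" where
  "overlap t t' \<longleftrightarrow> fst t \<inter> fst t' \<noteq> {} \<and> snd t \<inter> snd t' \<noteq> {}"

definition is_tiling :: "('n, 'm) tile set \<Rightarrow> bool" where
  "is_tiling T \<longleftrightarrow> (\<forall>t\<in>T. \<forall>t'\<in>T. t \<noteq> t' \<longrightarrow> \<not> overlap t t')"

definition equivalent_tiles :: "('n, 'm) tile set \<Rightarrow> ('n, 'm) tile set \<Rightarrow> bool" where
  "equivalent_tiles T T' \<longleftrightarrow> allowed T = allowed T'"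

text \<open>
  A sum of two tilings is determined only up to equivalence, so it is a relation:
  \<open>is_tiling_sum T T' S\<close> says that \<open>S\<close> may serve as \<open>T + T'\<close>.
\<close>

definition is_tiling_sum ::
    "('n, 'm) tile set \<Rightarrow> ('n, 'm) tile set \<Rightarrow> ('n, 'm) tile set \<Rightarrow> bool" where
  "is_tiling_sum T T' S \<longleftrightarrow> is_tiling S \<and> equivalent_tiles S (T \<union> T')"

definition hypothesis_tilings :: "('n, 'm) tile set \<Rightarrow> ('n, 'm) tile set \<Rightarrow> bool" where
  "hypothesis_tilings TH1 TH2 \<longleftrightarrow>
     (\<exists>R C (k::nat) Cs. (\<Union>l\<in>{1..k}. Cs l) = C \<and> disjoint_family_on Cs {1..k} \<and>
        TH1 = {(R, C)} \<and> TH2 = (\<lambda>l. (R, Cs l)) ` {1..k})"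

definition center_columns :: "real^'m^'n \<Rightarrow> real^'m^'n" where
  "center_columns X = (\<chi> i l. X $ i $ l - (1 / real CARD('n)) * (\<Sum>k\<in>UNIV. X $ k $ l))"

text \<open>
  The uniform distribution is on the permutation vectors allowed by \<open>T\<close>, not on the set of
  distinct matrices they produce: a matrix arising from several \<open>p\<close> (for instance when \<open>X\<close>
  has repeated entries) is weighted accordingly. The set \<open>allowed T\<close> is finite and contains
  the identity vector, so \<open>pmf_of_set\<close> is meaningful.
\<close>

definition covariance :: "real^'m^'n \<Rightarrow> ('n::finite, 'm::finite) tile set \<Rightarrow> real^'m^'m" where
  "covariance X T = (\<chi> j j'. measure_pmf.expectation (pmf_of_set (allowed T))
     (\<lambda>p. (1 / real CARD('n)) *
        (\<Sum>i\<in>UNIV. permute_matrix p (center_columns X) $ i $ j *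
                  permute_matrix p (center_columns X) $ i $ j')))"

definition first_principal_component :: "real^'m^'m \<Rightarrow> real^'m \<Rightarrow> bool" where
  "first_principal_component A w \<longleftrightarrow> norm w = 1 \<and>
     (\<exists>ev. A *v w = ev *\<^sub>R w \<and> (\<forall>\<mu> u. u \<noteq> 0 \<and> A *v u = \<mu> *\<^sub>R u \<longrightarrow> \<mu> \<le> ev))"

definition gain ::
    "real^'m^'n \<Rightarrow> real^'m \<Rightarrow> ('n::finite, 'm::finite) tile set \<times> ('n, 'm) tile set \<Rightarrow> real" where
  "gain X v H = (v \<bullet> (covariance X (fst H) *v v)) / (v \<bullet> (covariance X (snd H) *v v))"

end

(* Substituting v = W *v u turns the gain into the Rayleigh quotient of the symmetric matrix
   B = transpose W ** S1 ** W, because the denominator becomes u \<bullet> u. The maximum of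
   that quotient is attained on the compact unit sphere, and a maximiser is an eigenvector, so
   the maximum is the largest eigenvalue of B. *)
theory Submission
  imports Defs
begin

lemma inner_congruence_matrix:
  fixes W :: "real^'k^'m" and S :: "real^'m^'m"
  shows "u \<bullet> ((transpose W ** S ** W) *v u) = (W *v u) \<bullet> (S *v (W *v u))"
proof -
  have "u \<bullet> ((transpose W ** S ** W) *v u) = u \<bullet> (transpose W *v (S *v (W *v u)))"
    by (simp flip: matrix_vector_mul_assoc)
  also have "\<dots> = (u v* transpose W) \<bullet> (S *v (W *v u))"
    by (rule dot_lmul_matrix [symmetric])
  finally show ?thesis
    by simp
qed

text \<open>Scaling extends the maximum \<open>\<mu>\<close> from the unit sphere to the quadratic
  bound on all vectors. Perturbing the maximiser \<open>u\<close> along its residual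
  \<open>r\<close> then shows that this residual vanishes.\<close>

lemma symmetric_matrix_top_eigenvector:
  fixes A :: "real^'m^'m"
  assumes sym: "transpose A = A"
  obtains u \<mu> where "u \<noteq> 0" "A *v u = \<mu> *\<^sub>R u" "\<And>v. v \<bullet> (A *v v) \<le> \<mu> * (v \<bullet> v)"
proof -
  have "sphere (0::real^'m) 1 \<noteq> {}"
    by simp
  moreover have "continuous_on (sphere 0 1) (\<lambda>v. v \<bullet> (A *v v))"
    by (intro continuous_intros)
  ultimately have "\<exists>u\<in>sphere 0 1. \<forall>v\<in>sphere 0 1. v \<bullet> (A *v v) \<le> u \<bullet> (A *v u)"
    by (rule continuous_attains_sup[OF compact_sphere])
  then obtain u where u: "u \<in> sphere 0 1"
    and max: "\<And>v. v \<in> sphere 0 1 \<Longrightarrow> v \<bullet> (A *v v) \<le> u \<bullet> (A *v u)"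
    by blast
  define \<mu> where "\<mu> = u \<bullet> (A *v u)"
  have norm_u: "u \<bullet> u = 1"
    using u by (simp add: norm_eq_1)
  have bound: "v \<bullet> (A *v v) \<le> \<mu> * (v \<bullet> v)" for v
  proof (cases "v = 0")
    case False
    define s where "s = v /\<^sub>R norm v"
    have v: "v = norm v *\<^sub>R s" and "s \<in> sphere 0 1"
      using False by (simp_all add: s_def)
    then have "s \<bullet> (A *v s) \<le> \<mu>"
      using max by (simp add: \<mu>_def)
    then have "(norm v)\<^sup>2 * (s \<bullet> (A *v s)) \<le> (norm v)\<^sup>2 * \<mu>"
      by (intro mult_left_mono) auto
    moreover have "v \<bullet> (A *v v) = (norm v)\<^sup>2 * (s \<bullet> (A *v s))"
      by (subst (1 2) v) (simp add: matrix_vector_mult_scaleR power2_eq_square)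
    ultimately show ?thesis
      by (simp add: power2_norm_eq_inner mult.commute)
  qed simp
  \<comment> \<open>Half the gradient at \<open>u\<close> of the form
    \<open>\<mu> * (v \<bullet> v) - v \<bullet> (A *v v)\<close>, hence the direction to test;
    \<open>b\<close> is the value of this form at \<open>r\<close>.\<close>
  define r where "r = \<mu> *\<^sub>R u - A *v u"
  define a where "a = r \<bullet> r"
  define b where "b = \<mu> * (r \<bullet> r) - r \<bullet> (A *v r)"
  have "b \<ge> 0"
    using bound[of r] by (simp add: b_def)
  \<comment> \<open>Symmetry of \<open>A\<close> makes the two cross terms in the expansion at
    \<open>u + t *\<^sub>R r\<close> equal.\<close>
  have adj: "u \<bullet> (A *v r) = r \<bullet> (A *v u)"
    using dot_lmul_matrix[of u A r] sym
    by (simp add: inner_commute flip: transpose_matrix_vector)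
  \<comment> \<open>The form \<open>\<mu> * (v \<bullet> v) - v \<bullet> (A *v v)\<close> is nonnegative and vanishes at \<open>u\<close>,
    so its directional derivative at \<open>u\<close> along \<open>r\<close>, which is \<open>2 * (r \<bullet> r)\<close>, must be 0.\<close>
  have quad: "0 \<le> 2 * t * a + t\<^sup>2 * b" for t
  proof -
    have "0 \<le> \<mu> * ((u + t *\<^sub>R r) \<bullet> (u + t *\<^sub>R r)) - (u + t *\<^sub>R r) \<bullet> (A *v (u + t *\<^sub>R r))"
      using bound[of "u + t *\<^sub>R r"] by simp
    also have "\<dots> = \<mu> * (u \<bullet> u) - u \<bullet> (A *v u) + 2 * t * (\<mu> * (r \<bullet> u) - r \<bullet> (A *v u)) + t\<^sup>2 * b"
      using adj
      by (simp add: b_def inner_commute[of u r] power2_eq_square algebra_simps)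
    also have "\<mu> * (r \<bullet> u) - r \<bullet> (A *v u) = a"
      by (simp add: a_def r_def inner_diff_right)
    also have "\<mu> * (u \<bullet> u) - u \<bullet> (A *v u) = 0"
      by (simp add: norm_u \<mu>_def)
    finally show ?thesis
      by simp
  qed
  \<comment> \<open>For \<open>b > 0\<close> the quadratic in \<open>t\<close> is minimal at
    \<open>- a / b\<close>; using \<open>b + 1\<close> instead also covers \<open>b = 0\<close> and
    still gives a negative value unless \<open>a = 0\<close>. The factor
    \<open>(b + 1)\<^sup>2\<close> clears denominators.\<close>
  have "0 \<le> (2 * (- a / (b + 1)) * a + (- a / (b + 1))\<^sup>2 * b) * (b + 1)\<^sup>2"
    by (rule mult_nonneg_nonneg[OF quad]) simp
  also have "\<dots> = - (a\<^sup>2 * (b + 2))"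
    using \<open>b \<ge> 0\<close> by (simp add: divide_simps) (simp add: power2_eq_square algebra_simps)
  finally have "a\<^sup>2 * (b + 2) \<le> 0"
    by simp
  then have "a = 0"
    using \<open>b \<ge> 0\<close> by (simp add: mult_le_0_iff)
  then have "A *v u = \<mu> *\<^sub>R u"
    by (simp add: a_def r_def)
  moreover have "u \<noteq> 0"
    using norm_u by auto
  ultimately show ?thesis
    using that bound by blast
qed

text \<open>The definition compares \<open>ev\<close> only with other eigenvalues. Since the sharp
  bound \<open>\<mu>\<close> of the form is itself an eigenvalue, \<open>\<mu> \<le> ev\<close>, and
  \<open>ev = w \<bullet> (A *v w)\<close> because \<open>w\<close> is a unit vector.\<close>

lemma first_principal_component_maximises_quadratic_form:
  fixes A :: "real^'m^'m"
  assumes "transpose A = A" and "first_principal_component A w"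
  shows "u \<bullet> (A *v u) \<le> (w \<bullet> (A *v w)) * (u \<bullet> u)"
proof -
  obtain ev where w: "norm w = 1" "A *v w = ev *\<^sub>R w"
    and ev: "\<And>\<mu> u. u \<noteq> 0 \<Longrightarrow> A *v u = \<mu> *\<^sub>R u \<Longrightarrow> \<mu> \<le> ev"
    using assms(2) unfolding first_principal_component_def by blast
  obtain z \<mu> where "z \<noteq> 0" "A *v z = \<mu> *\<^sub>R z"
    and bound: "\<And>v. v \<bullet> (A *v v) \<le> \<mu> * (v \<bullet> v)"
    using symmetric_matrix_top_eigenvector[OF assms(1)] by metis
  then have "\<mu> \<le> ev"
    using ev by blast
  then have "u \<bullet> (A *v u) \<le> ev * (u \<bullet> u)"
    using bound[of u] mult_right_mono[of \<mu> ev "u \<bullet> u"] by simp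
  then show ?thesis
    using w by (simp add: norm_eq_1)
qed

lemma transpose_covariance: "transpose (covariance X T) = covariance X T"
  by (simp add: covariance_def transpose_def vec_eq_iff mult.commute)

theorem theorem10:
  fixes X :: "real^'m^'n"
    and Tu TH1 TH2 T1 T2 :: "('n::finite, 'm::finite) tile set"
    and W :: "real^'m^'m" and w :: "real^'m"
  assumes "is_tiling Tu"
    and "hypothesis_tilings TH1 TH2"
    and "is_tiling_sum Tu TH1 T1"
    and "is_tiling_sum Tu TH2 T2"
    and "transpose W ** covariance X T2 ** W = mat 1"
    and "first_principal_component (transpose W ** covariance X T1 ** W) w"
  shows "W *v w \<noteq> 0 \<and> (\<forall>v. v \<noteq> 0 \<longrightarrow> gain X v (T1, T2) \<le> gain X (W *v w) (T1, T2))"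
proof -
  \<comment> \<open>Whitening makes \<open>L\<close> a left inverse of \<open>W\<close>. As the
    matrices are square it is two-sided, so the substitution \<open>v = W *v u\<close> reaches every
    \<open>v\<close>.\<close>
  define L where "L = transpose W ** covariance X T2"
  define B where "B = transpose W ** covariance X T1 ** W"
  have LW: "L ** W = mat 1"
    using assms(5) by (simp add: L_def)
  then have WL: "W ** L = mat 1"
    by (simp add: matrix_left_right_inverse)
  have fpc: "first_principal_component B w"
    using assms(6) by (simp add: B_def)
  then have ww: "w \<bullet> w = 1"
    by (simp add: first_principal_component_def norm_eq_1)
  have "transpose B = B"
    by (simp add: B_def matrix_transpose_mul transpose_covariance matrix_mul_assoc)
  note max = first_principal_component_maximises_quadratic_form[OF this fpc]
  have gain_W: "gain X (W *v u) (T1, T2) = (u \<bullet> (B *v u)) / (u \<bullet> u)" for u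
    unfolding gain_def B_def fst_conv snd_conv inner_congruence_matrix[symmetric] assms(5)
    by simp
  have "W *v w \<noteq> 0"
  proof
    assume "W *v w = 0"
    then have "(L ** W) *v w = 0"
      by (simp flip: matrix_vector_mul_assoc)
    then show False
      using LW ww by simp
  qed
  moreover have "gain X v (T1, T2) \<le> gain X (W *v w) (T1, T2)" if "v \<noteq> 0" for v
  proof -
    define u where "u = L *v v"
    have v: "v = W *v u"
      by (simp add: u_def matrix_vector_mul_assoc WL)
    \<comment> \<open>If \<open>u\<close> were 0, then so would be \<open>v = W *v u\<close>; hence
      the Rayleigh quotient at \<open>u\<close> has a positive denominator.\<close>
    then have "u \<bullet> u > 0"
      using that by auto
    then show ?thesis
      using max[of u] by (simp add: v gain_W ww divide_simps)
  qed
  ultimately show ?thesis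
    by blast
qed

end
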